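(* For every $p\ge q\ge k+1$ there exists $c=c(p,q,k)$ such that the following holds. Let $H$ be a set of $k$ closed halfspaces in $\mathbb{R}^d$, let $P$ be a monotone property of $H$-convex sets, and let $\mathcal{B}$ be a finite family of $H$-convex sets in $\mathbb{R}^d$. If among every $p$ members of $\mathcal{B}$ some $q$ are $P$-intersecting, then there exists a family $\mathcal{F}$ of $H$-convex sets with property $P$ such that $|\mathcal{F}|\le c$ and for every $B\in\mathcal{B}$ there is a $D\in\mathcal{F}$ with $D\subseteq B$.
   Context: Let $H=\{H_1,\dots,H_k\}$ be a set of $k$ closed halfspaces in $\mathbb{R}^d$. An $H$-convex set $B$ in $\mathbb{R}^d$ is an intersection of $k$ halfspaces $H_1^B,\dots,H_k^B$ such that for each $i$ the halfspace $H_i^B$ is a translate of $H_i$. Intersections of nonempty finite families of $H$-convex sets are $H$-convex. A property $P$ of $H$-convex sets (a class of $H$-convex sets) is monotone if $B\in P$ and $B\subseteq C$ imply $C\in P$ for all $H$-convex sets $B,C$. A family of $H$-convex sets is $P$-intersecting if the intersection of its members has property $P$. Here $p$, $q$ and $k$ are integers.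
   Formalization: It is additionally assumed that every member of the family B has property P; without this the claim fails (P empty, B a single set, p at least 2), and by monotonicity the conclusion forces it. *)

theory Defs
  imports "Jordan_Normal_Form.Matrix"
begin

text \<open>The bound in the theorem may not depend on the dimension, so the dimension has to be an
  ordinary variable: $\mathbb{R}^d$ is the carrier \<open>carrier_vec d\<close> of the real vectors of length
  \<open>d\<close>.\<close>

definition closed_halfspace :: "nat \<Rightarrow> real vec set \<Rightarrow> bool" where
  "closed_halfspace d h \<longleftrightarrow>
     (\<exists>a \<in> carrier_vec d. \<exists>b. a \<noteq> 0\<^sub>v d \<and> h = {x \<in> carrier_vec d. a \<bullet> x \<le> b})"

definition translate_of :: "nat \<Rightarrow> real vec set \<Rightarrow> real vec set \<Rightarrow> bool" where
  "translate_of d h' h \<longleftrightarrow> (\<exists>v \<in> carrier_vec d. h' = (\<lambda>x. x + v) ` h)"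

text \<open>\<open>T h\<close> is the chosen translate of \<open>h\<close>. The factor \<open>carrier_vec d\<close> only matters for \<open>H = {}\<close>,
  where the empty intersection is the whole space.\<close>

definition H_convex :: "nat \<Rightarrow> real vec set set \<Rightarrow> real vec set \<Rightarrow> bool" where
  "H_convex d H B \<longleftrightarrow>
     (\<exists>T. (\<forall>h\<in>H. translate_of d (T h) h) \<and> B = carrier_vec d \<inter> (\<Inter>h\<in>H. T h))"

text \<open>A property is identified with the class of the \<open>H\<close>-convex sets that have it.\<close>

definition monotone_property :: "nat \<Rightarrow> real vec set set \<Rightarrow> real vec set set \<Rightarrow> bool" where
  "monotone_property d H P \<longleftrightarrow>
     (\<forall>B\<in>P. H_convex d H B) \<and>
     (\<forall>B C. H_convex d H B \<and> H_convex d H C \<and> B \<in> P \<and> B \<subseteq> C \<longrightarrow> C \<in> P)"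

text \<open>Only meant for nonempty families (\<open>\<Inter>{}\<close> is \<open>UNIV\<close>, not \<open>carrier_vec d\<close>).\<close>

definition P_intersecting :: "real vec set set \<Rightarrow> real vec set set \<Rightarrow> bool" where
  "P_intersecting P \<G> \<longleftrightarrow> \<Inter>\<G> \<in> P"

end

theory Submission
  imports Defs
begin

text \<open>
  Once normals are fixed, an \<open>H\<close>-convex set is given by the vector of its \<open>k\<close> offsets, one for each
  halfspace in \<open>H\<close>. Intersection becomes the coordinatewise minimum, a smaller vector gives a
  smaller set, and a monotone property becomes an upset \<open>Q\<close> of \<open>\<real>\<^sup>k\<close>. So the theorem is a statement
  about vectors: if among every \<open>p\<close> of finitely many vectors of \<open>Q\<close> some \<open>q \<ge> k + 1\<close> have their
  minimum in \<open>Q\<close>, then boundedly many points of \<open>Q\<close> suffice to have one below each vector. Neither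
  geometry nor the dimension \<open>d\<close> enters any more.

  The proof has the shape of the Alon--Kleitman proof of the \<open>(p,q)\<close>-theorem, and each of its three
  ingredients has an elementary form here.

  Fractional Helly (\<open>fractional_helly\<close>): a minimum of \<open>k + 1\<close> vectors in \<open>\<real>\<^sup>k\<close> is already the
  minimum of \<open>k\<close> of them, so the remaining vector lies above the minimum of the other \<open>k\<close>. A random
  sequence of bounded length contains such a configuration with its minimum in \<open>Q\<close>, hence some point
  of \<open>Q\<close> lies below a constant fraction of the vectors, for whatever weights the vectors carry. Here
  \<open>q \<ge> k + 1\<close> is used.

  Duality (\<open>often_hitting_sequence\<close>): in place of linear programming duality, the weights are updated
  multiplicatively, halving the weight of every vector that has just been hit. This produces a finite
  sequence of points of \<open>Q\<close> of which a constant fraction lies below each single vector.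

  Weak nets (\<open>weak_net\<close>): for such a sequence there are boundedly many points, each above a point of
  the sequence and so in \<open>Q\<close>, such that every vector above a constant fraction of the sequence is
  above one of them. This is an induction on the number of coordinates.
\<close>

section \<open>Upsets and coordinatewise minima\<close>

definition below_on :: "'h set \<Rightarrow> ('h \<Rightarrow> real) \<Rightarrow> ('h \<Rightarrow> real) \<Rightarrow> bool" where
  "below_on K x y \<longleftrightarrow> (\<forall>h\<in>K. x h \<le> y h)"

definition coord_min :: "('a \<Rightarrow> 'h \<Rightarrow> real) \<Rightarrow> 'a set \<Rightarrow> 'h \<Rightarrow> real" where
  "coord_min v J = (\<lambda>h. Min ((\<lambda>j. v j h) ` J))"

definition upset_on :: "'h set \<Rightarrow> ('h \<Rightarrow> real) set \<Rightarrow> bool" where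
  "upset_on K Q \<longleftrightarrow> (\<forall>x\<in>Q. \<forall>y. below_on K x y \<longrightarrow> y \<in> Q)"

lemma coord_min_antimono:
  assumes "finite J" "I \<subseteq> J" "I \<noteq> {}"
  shows "below_on K (coord_min v J) (coord_min v I)"
  unfolding below_on_def coord_min_def using assms
  by (auto intro!: Min_antimono)

lemma coord_min_image: "coord_min v (s ` I) = coord_min (\<lambda>i. v (s i)) I"
  unfolding coord_min_def by (simp add: image_image)

text \<open>
  Each of the \<open>card K\<close> coordinates of the minimum is attained by some index, so among \<open>card K + 1\<close>
  indices one is never needed. When \<open>K\<close> is empty the minimum over \<open>I - {i} = {}\<close> is an unspecified
  vector, but then \<open>below_on K\<close> holds for all pairs.
\<close>

lemma coord_min_drop_one:
  assumes "finite K" "finite I" "card I = card K + 1"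
  shows "\<exists>i\<in>I. below_on K (coord_min u I) (coord_min u (I - {i}))
    \<and> below_on K (coord_min u (I - {i})) (u i)"
proof -
  have "I \<noteq> {}" using assms by auto
  have "\<exists>i\<in>I. u i h = coord_min u I h" for h
  proof -
    have "coord_min u I h \<in> (\<lambda>j. u j h) ` I"
      unfolding coord_min_def using assms(2) \<open>I \<noteq> {}\<close> by (intro Min_in) auto
    then show ?thesis by auto
  qed
  \<comment> \<open>\<open>m h\<close> is an index at which coordinate \<open>h\<close> is minimal\<close>
  then obtain m where m: "m h \<in> I" "u (m h) h = coord_min u I h" for h by metis
  have "card (m ` K) < card I"
    using card_image_le[OF assms(1), of m] assms(3) by linarith
  then have "\<not> I \<subseteq> m ` K"
    using card_mono[of "m ` K" I] assms(1) by auto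
  then obtain i where i: "i \<in> I" "i \<notin> m ` K" by blast
  have le: "coord_min u (I - {i}) h \<le> coord_min u I h" if "h \<in> K" for h
  proof -
    have "m h \<in> I - {i}" using m(1) i(2) that by auto
    then have "coord_min u (I - {i}) h \<le> u (m h) h"
      unfolding coord_min_def using assms(2) by (intro Min_le) auto
    then show ?thesis using m(2) by simp
  qed
  moreover have "coord_min u I h \<le> u i h" for h
    unfolding coord_min_def using assms(2) i(1) by (intro Min_le) auto
  ultimately have "below_on K (coord_min u (I - {i})) (u i)"
    unfolding below_on_def by (meson order_trans)
  moreover have "below_on K (coord_min u I) (coord_min u (I - {i}))"
  proof (cases "K = {}")
    case False
    then have "m (SOME h. h \<in> K) \<in> I - {i}"
      using m(1) i(2) by (auto simp: some_in_eq)
    then show ?thesis using assms(2) by (intro coord_min_antimono) auto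
  qed (simp add: below_on_def)
  ultimately show ?thesis using i(1) by blast
qed

section \<open>Weak nets for lower orthants\<close>

text \<open>
  The sublevel sets of \<open>f\<close> on \<open>A\<close> are nested, and each one with at least \<open>M\<close> points agrees, up to fewer
  than \<open>M\<close> points, with one of at most \<open>r\<close> of them. The \<open>j\<close>-th threshold is the least value whose sublevel set has at least
  \<open>j * M\<close> points; counting points this way, and not cutting a sorted enumeration into blocks of size
  \<open>M\<close>, is what copes with ties.
\<close>

lemma few_thresholds:
  fixes f :: "'a \<Rightarrow> real"
  assumes "finite A" "card A \<le> r * M" "M \<ge> 1"
  obtains \<Theta> where "finite \<Theta>" "card \<Theta> \<le> r"
    "\<And>\<beta>. M \<le> card {a\<in>A. f a \<le> \<beta>} \<Longrightarrow>
      \<exists>t\<in>\<Theta>. t \<le> \<beta> \<and> card {a\<in>A. f a \<le> \<beta>} < card {a\<in>A. f a \<le> t} + M"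
proof -
  define V where "V j = f ` {a\<in>A. j * M \<le> card {a'\<in>A. f a' \<le> f a}}" for j
  \<comment> \<open>for \<open>j\<close> with \<open>V j = {}\<close> this adds an arbitrary number, which does no harm\<close>
  define \<Theta> where "\<Theta> = (\<lambda>j. Min (V j)) ` {1..r}"
  have finV: "finite (V j)" for j unfolding V_def using assms(1) by simp
  have "\<exists>t\<in>\<Theta>. t \<le> \<beta> \<and> card {a\<in>A. f a \<le> \<beta>} < card {a\<in>A. f a \<le> t} + M"
    if \<beta>: "M \<le> card {a\<in>A. f a \<le> \<beta>}" for \<beta>
  proof -
    let ?S = "{a\<in>A. f a \<le> \<beta>}"
    define j where "j = card ?S div M"
    have "card ?S \<le> r * M"
      using card_mono[of A ?S] assms(1,2) by auto
    then have "j \<le> r * M div M" unfolding j_def by (rule div_le_mono)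
    then have "j \<le> r" using assms(3) by simp
    moreover have "j \<ge> 1" unfolding j_def using \<beta> assms(3)
      by (simp add: div_greater_zero_iff Suc_le_eq)
    ultimately have j: "j \<in> {1..r}" by simp
    have finS: "finite ?S" using assms(1) by simp
    have "?S \<noteq> {}" using \<beta> assms(3) by (metis card.empty not_one_le_zero order_trans)
    \<comment> \<open>the largest value \<open>f a\<close> below \<open>\<beta>\<close> has the same sublevel set as \<open>\<beta>\<close>, so it competes for
      the \<open>j\<close>-th threshold\<close>
    then have "Max (f ` ?S) \<in> f ` ?S" using finS by (intro Max_in) auto
    then obtain a where a: "a \<in> ?S" "f a = Max (f ` ?S)" by auto
    have "{a'\<in>A. f a' \<le> f a} = ?S"
      using a finS by (auto intro: order_trans)
    then have "f a \<in> V j"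
      unfolding V_def using a(1) by (auto simp: j_def)
    then have "Min (V j) \<le> f a" "Min (V j) \<in> V j"
      using finV by (auto intro: Min_le Min_in)
    moreover from this(2) have "j * M \<le> card {a'\<in>A. f a' \<le> Min (V j)}"
      unfolding V_def by auto
    moreover have "card ?S < j * M + M"
      unfolding j_def using assms(3) dividend_less_div_times[of M "card ?S"] by simp
    ultimately show ?thesis
      using a(1) j unfolding \<Theta>_def by (intro bexI[of _ "Min (V j)"]) auto
  qed
  moreover have "finite \<Theta>" "card \<Theta> \<le> r"
    unfolding \<Theta>_def using card_image_le[of "{1..r}" "\<lambda>j. Min (V j)"] by auto
  ultimately show thesis using that by blast
qed

text \<open>
  Replacing the bound \<open>b h\<close> in one coordinate \<open>h\<close> by the next lower threshold loses fewer than \<open>M\<close> of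
  the points below \<open>b\<close>; this is why \<open>card K + 1\<close> portions of \<open>M\<close> points are required at the start. For
  each threshold \<open>t\<close> the points with \<open>h\<close>-coordinate at most \<open>t\<close> have a net in the remaining coordinates.
  Setting coordinate \<open>h\<close> of the net points to \<open>t\<close> keeps each of them above a point of the family.
\<close>

lemma weak_net:
  fixes x :: "'a \<Rightarrow> 'h \<Rightarrow> real"
  assumes "finite K" "finite A" "card A \<le> r * M" "M \<ge> 1"
  shows "\<exists>N. finite N \<and> card N \<le> r ^ card K
    \<and> (\<forall>y\<in>N. \<exists>a\<in>A. below_on K (x a) y)
    \<and> (\<forall>b. (card K + 1) * M \<le> card {a\<in>A. below_on K (x a) b} \<longrightarrow> (\<exists>y\<in>N. below_on K y b))"
  using assms(1-3)
proof (induction K arbitrary: A rule: finite_induct)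
  case empty
  show ?case
  proof (cases "A = {}")
    case True
    then show ?thesis using assms(4) by (intro exI[of _ "{}"]) auto
  next
    case False
    then obtain a where "a \<in> A" by blast
    then show ?thesis by (intro exI[of _ "{x a}"]) (auto simp: below_on_def)
  qed
next
  case (insert h K)
  obtain \<Theta> where \<Theta>: "finite \<Theta>" "card \<Theta> \<le> r"
    "\<And>\<beta>. M \<le> card {a\<in>A. x a h \<le> \<beta>} \<Longrightarrow>
      \<exists>t\<in>\<Theta>. t \<le> \<beta> \<and> card {a\<in>A. x a h \<le> \<beta>} < card {a\<in>A. x a h \<le> t} + M"
    using few_thresholds[OF insert.prems assms(4), of "\<lambda>a. x a h"] by blast
  define A' where "A' t = {a\<in>A. x a h \<le> t}" for t
  have "finite (A' t)" "card (A' t) \<le> r * M" for t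
    using insert.prems card_mono[of A "A' t"] unfolding A'_def by auto
  then have "\<forall>t. \<exists>N. finite N \<and> card N \<le> r ^ card K
    \<and> (\<forall>y\<in>N. \<exists>a\<in>A' t. below_on K (x a) y)
    \<and> (\<forall>b. (card K + 1) * M \<le> card {a\<in>A' t. below_on K (x a) b} \<longrightarrow> (\<exists>y\<in>N. below_on K y b))"
    using insert.IH by blast
  from choice[OF this] obtain N where N: "\<And>t. finite (N t)" "\<And>t. card (N t) \<le> r ^ card K"
    "\<And>t y. y \<in> N t \<Longrightarrow> \<exists>a\<in>A' t. below_on K (x a) y"
    "\<And>t b. (card K + 1) * M \<le> card {a\<in>A' t. below_on K (x a) b} \<Longrightarrow> \<exists>y\<in>N t. below_on K y b"
    by blast
  define N' where "N' = (\<Union>t\<in>\<Theta>. (\<lambda>y. y(h := t)) ` N t)"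
  have "finite N'" unfolding N'_def using \<Theta>(1) N(1) by auto
  moreover have "card N' \<le> r ^ card (insert h K)"
  proof -
    have "card N' \<le> (\<Sum>t\<in>\<Theta>. card ((\<lambda>y. y(h := t)) ` N t))"
      unfolding N'_def by (rule card_UN_le[OF \<Theta>(1)])
    also have "\<dots> \<le> (\<Sum>t\<in>\<Theta>. r ^ card K)"
      by (intro sum_mono order_trans[OF card_image_le N(2)] N(1))
    also have "\<dots> \<le> r * r ^ card K" using \<Theta>(2) by simp
    finally show ?thesis using insert.hyps by simp
  qed
  moreover have "\<exists>a\<in>A. below_on (insert h K) (x a) z" if "z \<in> N'" for z
  proof -
    obtain t y where z: "z = y(h := t)" "y \<in> N t" using \<open>z \<in> N'\<close> unfolding N'_def by blast
    then obtain a where "a \<in> A' t" "below_on K (x a) y" using N(3) by blast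
    then show ?thesis using insert.hyps(2) unfolding z(1) A'_def below_on_def
      by (intro bexI[of _ a]) auto
  qed
  moreover have "\<exists>z\<in>N'. below_on (insert h K) z b"
    if b: "(card (insert h K) + 1) * M \<le> card {a\<in>A. below_on (insert h K) (x a) b}" for b
  proof -
    let ?S = "{a\<in>A. below_on (insert h K) (x a) b}" and ?T = "{a\<in>A. x a h \<le> b h}"
    have S: "(card K + 1) * M + M \<le> card ?S" using b insert.hyps by (simp add: algebra_simps)
    have finT: "finite ?T" using insert.prems by simp
    have ST: "?S \<subseteq> ?T" by (auto simp: below_on_def)
    then have "card ?S \<le> card ?T" by (rule card_mono[OF finT])
    then obtain t where t: "t \<in> \<Theta>" "t \<le> b h" "card ?T < card (A' t) + M"
      using \<Theta>(3)[of "b h"] S unfolding A'_def by force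
    have sub: "A' t \<subseteq> ?T" unfolding A'_def using t(2) by auto
    have "card ?S \<le> card (?S \<inter> A' t) + card (?T - A' t)"
    proof -
      have "card ?S \<le> card ((?S \<inter> A' t) \<union> (?T - A' t))"
        using ST finT by (intro card_mono) (auto simp: A'_def intro: finite_subset)
      then show ?thesis using card_Un_le order_trans by blast
    qed
    moreover have "card (?T - A' t) < M"
      using t(3) sub finT card_mono[OF finT sub] finite_subset[OF sub finT]
      by (simp add: card_Diff_subset)
    moreover have "card (?S \<inter> A' t) \<le> card {a\<in>A' t. below_on K (x a) b}"
      using finite_subset[OF sub finT] by (intro card_mono) (auto simp: below_on_def)
    ultimately have "(card K + 1) * M \<le> card {a\<in>A' t. below_on K (x a) b}"
      using S by linarith
    then obtain y where "y \<in> N t" "below_on K y b" using N(4) by blast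
    then show ?thesis using t(1,2) unfolding N'_def below_on_def
      by (intro bexI[of _ "y(h := t)"]) auto
  qed
  ultimately show ?case by blast
qed

section \<open>From weighted hitting to a hitting sequence\<close>

text \<open>
  A multiplicative-weights substitute for linear programming duality. Give \<open>b\<close> the weight \<open>1/2\<close> to the
  power of the number of times it has been hit. Some point hits at least the fraction \<open>1/C\<close> of the total
  weight, so choosing it multiplies the total by at most \<open>1 - 1/(2C)\<close>. After \<open>r * m\<close> rounds the total is
  at most \<open>card B / 4^m < 1 / 2^m\<close>, so that no \<open>b\<close> can have been hit fewer than \<open>m\<close> times. As \<open>r\<close> depends
  on \<open>C\<close> only, \<open>m\<close> is a constant fraction of the length of the sequence.
\<close>

lemma often_hitting_sequence:
  fixes R :: "'x \<Rightarrow> 'b \<Rightarrow> bool" and C :: real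
  assumes "finite B" "C \<ge> 1"
    and heavy: "\<And>w :: 'b \<Rightarrow> real. (\<And>b. w b > 0) \<Longrightarrow> \<exists>x\<in>X. sum w B \<le> C * sum w {b\<in>B. R x b}"
    and r: "(1 - 1 / (2 * C)) ^ r \<le> 1 / 4"
    and m: "card B < 2 ^ m"
  shows "\<exists>x. (\<forall>i<r * m. x i \<in> X) \<and> (\<forall>b\<in>B. m \<le> card {i\<in>{..<r * m}. R (x i) b})"
proof -
  define hits :: "(nat \<Rightarrow> 'x) \<Rightarrow> nat \<Rightarrow> 'b \<Rightarrow> nat"
    where "hits x T b = card {i\<in>{..<T}. R (x i) b}" for x T b
  have C: "0 \<le> 1 - 1 / (2 * C)" using assms(2) by (simp add: field_simps)
  have "\<exists>x. (\<forall>i<T. x i \<in> X) \<and>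
      (\<Sum>b\<in>B. (1 / 2 :: real) ^ hits x T b) \<le> real (card B) * (1 - 1 / (2 * C)) ^ T" for T
  proof (induction T)
    case 0
    then show ?case by (simp add: hits_def)
  next
    case (Suc T)
    then obtain x where x: "\<forall>i<T. x i \<in> X"
      and IH: "(\<Sum>b\<in>B. (1 / 2 :: real) ^ hits x T b) \<le> real (card B) * (1 - 1 / (2 * C)) ^ T" by blast
    define w :: "'b \<Rightarrow> real" where "w b = (1 / 2) ^ hits x T b" for b
    obtain y where y: "y \<in> X" "sum w B \<le> C * sum w {b\<in>B. R y b}"
      using heavy[of w] by (auto simp: w_def)
    define x' where "x' = x(T := y)"
    have hits': "hits x' (Suc T) b = hits x T b + (if R y b then 1 else 0)" for b
    proof -
      have "{i\<in>{..<Suc T}. R (x' i) b} = {i\<in>{..<T}. R (x i) b} \<union> (if R y b then {T} else {})"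
        unfolding x'_def by (auto simp: less_Suc_eq split: if_splits)
      then show ?thesis unfolding hits_def by (simp add: card_Un_disjoint)
    qed
    have "(\<Sum>b\<in>B. (1 / 2 :: real) ^ hits x' (Suc T) b) = (\<Sum>b\<in>B. w b - (if R y b then w b / 2 else 0))"
      unfolding hits' w_def by (intro sum.cong) auto
    also have "\<dots> = sum w B - sum w {b\<in>B. R y b} / 2"
      using assms(1) by (simp add: sum_subtractf sum.inter_filter[symmetric] sum_divide_distrib)
    also have "\<dots> \<le> sum w B * (1 - 1 / (2 * C))"
      using y(2) assms(2) by (simp add: field_simps)
    also have "\<dots> \<le> real (card B) * (1 - 1 / (2 * C)) ^ T * (1 - 1 / (2 * C))"
      using IH C unfolding w_def by (intro mult_right_mono) auto
    finally have "(\<Sum>b\<in>B. (1 / 2 :: real) ^ hits x' (Suc T) b) \<le> real (card B) * (1 - 1 / (2 * C)) ^ Suc T"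
      by (simp add: mult_ac)
    moreover have "\<forall>i<Suc T. x' i \<in> X" using x y(1) by (auto simp: x'_def less_Suc_eq)
    ultimately show ?case by blast
  qed
  from this[of "r * m"] obtain x where x: "\<forall>i<r * m. x i \<in> X"
    and sum: "(\<Sum>b\<in>B. (1 / 2 :: real) ^ hits x (r * m) b) \<le> real (card B) * (1 - 1 / (2 * C)) ^ (r * m)" by blast
  have "m \<le> hits x (r * m) b" if "b \<in> B" for b
  proof (rule ccontr)
    assume "\<not> m \<le> hits x (r * m) b"
    then have "(1 / 2 :: real) ^ m \<le> (1 / 2) ^ hits x (r * m) b"
      by (intro power_decreasing) auto
    also have "\<dots> \<le> (\<Sum>b\<in>B. (1 / 2 :: real) ^ hits x (r * m) b)"
      using assms(1) that by (intro member_le_sum) auto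
    also note sum
    also have "real (card B) * (1 - 1 / (2 * C)) ^ (r * m) \<le> card B * (1 / 4) ^ m"
      unfolding power_mult using r C by (intro mult_left_mono power_mono) auto
    also have "\<dots> < 2 ^ m * (1 / 4) ^ m"
    proof -
      have "real (card B) < 2 ^ m" using m by (metis of_nat_less_iff of_nat_numeral of_nat_power)
      then show ?thesis by simp
    qed
    also have "\<dots> = (1 / 2 :: real) ^ m" by (simp flip: power_mult_distrib)
    finally show False by simp
  qed
  then show ?thesis using x unfolding hits_def by blast
qed

section \<open>A weighted fractional Helly theorem for upsets\<close>

text \<open>
  Fubini for product weights: the entry at \<open>i\<close> is summed last, with the other entries fixed.
\<close>

lemma sum_prod_PiE_insert:
  fixes w :: "'b \<Rightarrow> real"
  assumes "finite S" "i \<notin> S" "finite B"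
  shows "(\<Sum>s\<in>PiE (insert i S) (\<lambda>_. B). (\<Prod>j\<in>insert i S. w (s j)) * F s)
    = (\<Sum>g\<in>PiE S (\<lambda>_. B). (\<Prod>j\<in>S. w (g j)) * (\<Sum>b\<in>B. w b * F (g(i := b))))"
proof -
  have inj: "inj_on (\<lambda>(y, g). g(i := y)) (B \<times> PiE S (\<lambda>_. B))"
    by (rule inj_combinator[OF assms(2)])
  have "(\<Sum>s\<in>PiE (insert i S) (\<lambda>_. B). (\<Prod>j\<in>insert i S. w (s j)) * F s)
    = (\<Sum>(b, g)\<in>B \<times> PiE S (\<lambda>_. B). (\<Prod>j\<in>insert i S. w ((g(i := b)) j)) * F (g(i := b)))"
    unfolding PiE_insert_eq by (subst sum.reindex[OF inj]) (simp add: case_prod_unfold o_def)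
  also have "\<dots> = (\<Sum>(b, g)\<in>B \<times> PiE S (\<lambda>_. B). (\<Prod>j\<in>S. w (g j)) * (w b * F (g(i := b))))"
  proof (intro sum.cong refl, clarify)
    fix b g
    have "(\<Prod>j\<in>S. w ((g(i := b)) j)) = (\<Prod>j\<in>S. w (g j))"
      using assms(2) by (intro prod.cong) auto
    then show "(\<Prod>j\<in>insert i S. w ((g(i := b)) j)) * F (g(i := b))
      = (\<Prod>j\<in>S. w (g j)) * (w b * F (g(i := b)))"
      using assms(1,2) by (simp add: mult_ac)
  qed
  also have "\<dots> = (\<Sum>b\<in>B. \<Sum>g\<in>PiE S (\<lambda>_. B). (\<Prod>j\<in>S. w (g j)) * (w b * F (g(i := b))))"
    by (simp add: sum.cartesian_product)
  also have "\<dots> = (\<Sum>g\<in>PiE S (\<lambda>_. B). (\<Prod>j\<in>S. w (g j)) * (\<Sum>b\<in>B. w b * F (g(i := b))))"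
    by (subst sum.swap) (simp add: sum_distrib_left)
  finally show ?thesis .
qed

text \<open>
  Weight a sequence \<open>s\<close> of length \<open>N\<close> by the product of the weights of its entries; the total weight is
  \<open>W^N\<close>. By \<open>coord_min_drop_one\<close> every sequence has an index \<open>i\<close> and a set \<open>J\<close> of other indices such that
  the minimum over \<open>J\<close> is in \<open>Q\<close> and lies below the entry at \<open>i\<close>. There are \<open>N * 2^(N-1)\<close> pairs \<open>(i, J)\<close>.
  If all points of \<open>Q\<close> lay below less than the fraction \<open>1/(N * 2^N)\<close> of the weight, then, with the other
  entries fixed, the event for one pair would leave less than that fraction for the entry at \<open>i\<close>, and
  all pairs together would account for at most \<open>W^N / 2\<close>.
\<close>

lemma fractional_helly:
  fixes v :: "'b \<Rightarrow> 'h \<Rightarrow> real" and w :: "'b \<Rightarrow> real"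
  assumes "finite K" "upset_on K Q" "finite B" "B \<noteq> {}" "\<And>b. w b > 0" "N \<ge> 1"
    and good: "\<And>s. s \<in> {..<N} \<rightarrow> B \<Longrightarrow>
      \<exists>I\<subseteq>{..<N}. card I = card K + 1 \<and> coord_min (\<lambda>i. v (s i)) I \<in> Q"
  shows "\<exists>y\<in>Q. sum w B \<le> real (N * 2 ^ N) * sum w {b\<in>B. below_on K y (v b)}"
proof (rule ccontr)
  assume "\<not> ?thesis"
  then have light: "real (N * 2 ^ N) * sum w {b\<in>B. below_on K y (v b)} < sum w B" if "y \<in> Q" for y
    using that by force
  define W where "W = sum w B"
  have W: "W > 0" unfolding W_def using assms(3-5) by (intro sum_pos) auto
  define \<delta> where "\<delta> = W / real (N * 2 ^ N)"
  have \<delta>: "\<delta> \<ge> 0" unfolding \<delta>_def using W by simp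
  define y where "y s J = coord_min (\<lambda>j. v (s j)) J" for s :: "nat \<Rightarrow> 'b" and J
  define E where "E i J s \<longleftrightarrow> y s J \<in> Q \<and> below_on K (y s J) (v (s i))" for i :: nat and J s
  let ?n = "{..<N}"
  let ?S = "PiE ?n (\<lambda>_. B)"
  let ?pr = "\<lambda>s. \<Prod>j<N. w (s j)"
  have pr: "?pr s \<ge> 0" for s using assms(5) by (intro prod_nonneg) (auto intro: less_imp_le)
  have total: "(\<Sum>g\<in>PiE S (\<lambda>_. B). \<Prod>j\<in>S. w (g j)) = W ^ card S" if "finite S" for S :: "nat set"
    using prod_sum_PiE[of S "\<lambda>_. B" "\<lambda>_. w"] that assms(3) by (simp add: W_def)
  have covered: "1 \<le> (\<Sum>i<N. \<Sum>J\<in>Pow (?n - {i}). of_bool (E i J s) :: real)" if "s \<in> ?S" for s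
  proof -
    have "s \<in> ?n \<rightarrow> B" using that by auto
    then obtain I where I: "I \<subseteq> ?n" "card I = card K + 1" "y s I \<in> Q"
      using good unfolding y_def by blast
    obtain i where i: "i \<in> I" "below_on K (y s I) (y s (I - {i}))" "below_on K (y s (I - {i})) (v (s i))"
      using coord_min_drop_one[OF assms(1) finite_subset[OF I(1)] I(2), of "\<lambda>i. v (s i)"]
      unfolding y_def by auto
    have "y s (I - {i}) \<in> Q"
      using assms(2) I(3) i(2) unfolding upset_on_def by blast
    then have E: "E i (I - {i}) s" unfolding E_def using i(3) by simp
    have "(1::real) = of_bool (E i (I - {i}) s)" using E by simp
    also have "\<dots> \<le> (\<Sum>J\<in>Pow (?n - {i}). of_bool (E i J s))"
      using I(1) by (intro member_le_sum) auto
    also have "\<dots> \<le> (\<Sum>i<N. \<Sum>J\<in>Pow (?n - {i}). of_bool (E i J s))"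
      using I(1) i(1) by (intro member_le_sum[of i "{..<N}"] sum_nonneg) auto
    finally show ?thesis .
  qed
  have rare: "(\<Sum>s\<in>?S. ?pr s * of_bool (E i J s)) \<le> W ^ (N - 1) * \<delta>"
    if i: "i < N" and J: "J \<subseteq> ?n - {i}" for i J
  proof -
    define S where "S = ?n - {i}"
    have S: "?n = insert i S" "finite S" "i \<notin> S" "card S = N - 1" using i by (auto simp: S_def)
    have "(\<Sum>b\<in>B. w b * of_bool (E i J (g(i := b)))) \<le> \<delta>" for g
    proof -
      have y: "y (g(i := b)) J = y g J" for b
      proof -
        have "(\<lambda>j. v ((g(i := b)) j) h) ` J = (\<lambda>j. v (g j) h) ` J" for h
          using J by (intro image_cong) auto
        then show ?thesis unfolding y_def coord_min_def by simp
      qed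
      show ?thesis
      proof (cases "y g J \<in> Q")
        case True
        have "(\<Sum>b\<in>B. w b * of_bool (E i J (g(i := b)))) = sum w {b\<in>B. below_on K (y g J) (v b)}"
          using True assms(3) by (auto simp: E_def y sum.inter_filter of_bool_def intro!: sum.cong)
        then show ?thesis using light[OF True] assms(6) unfolding \<delta>_def W_def
          by (simp add: field_simps)
      next
        case False
        then show ?thesis using \<delta> by (simp add: E_def y)
      qed
    qed
    then have "(\<Sum>g\<in>PiE S (\<lambda>_. B). (\<Prod>j\<in>S. w (g j)) * (\<Sum>b\<in>B. w b * of_bool (E i J (g(i := b)))))
      \<le> (\<Sum>g\<in>PiE S (\<lambda>_. B). (\<Prod>j\<in>S. w (g j)) * \<delta>)"
      using assms(5) by (intro sum_mono mult_left_mono prod_nonneg) (auto intro: less_imp_le)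
    also have "\<dots> = W ^ (N - 1) * \<delta>"
      by (simp add: sum_distrib_right[symmetric] total[OF S(2)] S(4))
    finally show ?thesis
      using sum_prod_PiE_insert[OF S(2,3) assms(3), of w "\<lambda>s. of_bool (E i J s)"] S(1) by simp
  qed
  have "W ^ N = (\<Sum>s\<in>?S. ?pr s)" using total[of ?n] by simp
  also have "\<dots> \<le> (\<Sum>s\<in>?S. ?pr s * (\<Sum>i<N. \<Sum>J\<in>Pow (?n - {i}). of_bool (E i J s)))"
  proof (intro sum_mono)
    fix s assume "s \<in> ?S"
    from mult_left_mono[OF covered[OF this] pr[of s]]
    show "?pr s \<le> ?pr s * (\<Sum>i<N. \<Sum>J\<in>Pow (?n - {i}). of_bool (E i J s))" by simp
  qed
  also have "\<dots> = (\<Sum>i<N. \<Sum>J\<in>Pow (?n - {i}). \<Sum>s\<in>?S. ?pr s * of_bool (E i J s))"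
    unfolding sum_distrib_left by (subst sum.swap) (intro sum.cong refl, rule sum.swap)
  also have "\<dots> \<le> (\<Sum>i<N. \<Sum>J\<in>Pow (?n - {i}). W ^ (N - 1) * \<delta>)"
    using rare by (intro sum_mono) auto
  also have "\<dots> = (\<Sum>i<N. 2 ^ (N - 1) * (W ^ (N - 1) * \<delta>))"
    by (intro sum.cong) (auto simp: card_Pow)
  also have "\<dots> = W ^ N / 2"
  proof -
    obtain n where n: "N = Suc n" using assms(6) by (cases N) auto
    have "W ^ N = W * W ^ n" "(2::real) ^ N = 2 * 2 ^ n" "N - 1 = n" "real N > 0"
      using n by simp_all
    then show ?thesis unfolding \<delta>_def by (simp add: field_simps)
  qed
  finally show False using W by simp
qed

section \<open>The theorem for vectors and upsets\<close>

text \<open>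
  Sampling with weights produces repetitions, so the hypothesis on sets of \<open>p\<close> distinct members has to be
  carried over to sequences. A sequence of length \<open>(k + 1) * p\<close> has \<open>p\<close> distinct entries or takes some
  value at least \<open>k + 1\<close> times, and in the latter case the minimum is that single value, which is in \<open>Q\<close>.
\<close>

lemma pq_for_sequences:
  assumes "finite B" "upset_on K Q" "\<And>b. b \<in> B \<Longrightarrow> v b \<in> Q" "k + 1 \<le> q" "p \<ge> 1"
    and pq: "\<And>G. G \<subseteq> B \<Longrightarrow> card G = p \<Longrightarrow> \<exists>L\<subseteq>G. card L = q \<and> coord_min v L \<in> Q"
    and s: "s \<in> {..<(k + 1) * p} \<rightarrow> B"
  shows "\<exists>I\<subseteq>{..<(k + 1) * p}. card I = k + 1 \<and> coord_min (\<lambda>i. v (s i)) I \<in> Q"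
proof -
  let ?n = "{..<(k + 1) * p}"
  show ?thesis
  proof (cases "p \<le> card (s ` ?n)")
    case True
    then obtain G where G: "G \<subseteq> s ` ?n" "card G = p" by (meson obtain_subset_with_card_n)
    then have "G \<subseteq> B" using s by auto
    then obtain L where L: "L \<subseteq> G" "card L = q" "coord_min v L \<in> Q" using pq G(2) by blast
    obtain L' where L': "L' \<subseteq> L" "card L' = k + 1"
      using assms(4) L(2) obtain_subset_with_card_n by metis
    have "finite L" using L(2) assms(4) card.infinite by fastforce
    moreover have "L' \<noteq> {}" using L'(2) by auto
    ultimately have "coord_min v L' \<in> Q"
      using coord_min_antimono[of L L' K v] L'(1) L(3) assms(2) unfolding upset_on_def by blast
    moreover have "L' \<subseteq> s ` ?n" using L'(1) L(1) G(1) by blast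
    then obtain I where "I \<subseteq> ?n" "inj_on s I" "L' = s ` I" by (meson subset_image_inj)
    ultimately show ?thesis
      using L'(2) by (intro exI[of _ I]) (simp add: coord_min_image card_image)
  next
    case False
    have "\<exists>b\<in>s ` ?n. k + 1 \<le> card {i\<in>?n. s i = b}"
    proof (rule ccontr)
      assume "\<not> ?thesis"
      then have small: "card {i\<in>?n. s i = b} \<le> k" if "b \<in> s ` ?n" for b
        using that by force
      have "card ?n \<le> card (\<Union>b\<in>s ` ?n. {i\<in>?n. s i = b})"
        by (intro card_mono) auto
      also have "\<dots> \<le> (\<Sum>b\<in>s ` ?n. card {i\<in>?n. s i = b})"
        by (rule card_UN_le) simp
      also have "\<dots> \<le> card (s ` ?n) * k"
        using sum_mono[of "s ` ?n" _ "\<lambda>_. k", OF small] by simp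
      also have "\<dots> \<le> p * k" using False by simp
      finally show False using assms(5) by simp
    qed
    then obtain b I where b: "b \<in> s ` ?n" and I: "I \<subseteq> {i\<in>?n. s i = b}" "card I = k + 1"
      by (meson obtain_subset_with_card_n)
    have "I \<noteq> {}" using I(2) by auto
    then have "s ` I = {b}" using I(1) by auto
    then have "coord_min (\<lambda>i. v (s i)) I = v b"
      unfolding coord_min_image[symmetric] by (simp add: coord_min_def)
    moreover have "b \<in> B" using b s by auto
    ultimately show ?thesis using assms(3) I by (intro exI[of _ I]) auto
  qed
qed

lemma upset_pq:
  fixes v :: "'b \<Rightarrow> 'h \<Rightarrow> real"
  assumes "finite K" "card K = k" "upset_on K Q" "finite B" "\<And>b. b \<in> B \<Longrightarrow> v b \<in> Q"
    and "k + 1 \<le> q" "q \<le> p"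
    and pq: "\<And>G. G \<subseteq> B \<Longrightarrow> card G = p \<Longrightarrow> \<exists>L\<subseteq>G. card L = q \<and> coord_min v L \<in> Q"
    and N: "N = (k + 1) * p"
    and r: "(1 - 1 / (2 * real (N * 2 ^ N))) ^ r \<le> 1 / 4"
  shows "\<exists>F\<subseteq>Q. finite F \<and> card F \<le> (r * (k + 1)) ^ k \<and> (\<forall>b\<in>B. \<exists>y\<in>F. below_on K y (v b))"
proof (cases "B = {}")
  case True
  then show ?thesis by (intro exI[of _ "{}"]) auto
next
  case False
  have p: "p \<ge> 1" using assms(6,7) by simp
  then have N1: "N \<ge> 1" unfolding N by simp
  \<comment> \<open>\<open>m\<close> is a multiple of \<open>k + 1\<close> to suit the net, and large enough that \<open>2 ^ m\<close> exceeds \<open>card B\<close>; it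
    cancels from the size of the net\<close>
  define M where "M = card B + 1"
  define m where "m = (k + 1) * M"
  have "card B < 2 ^ card B" by (rule less_exp)
  also have "\<dots> \<le> (2::nat) ^ m"
    by (rule power_increasing) (auto simp: m_def M_def)
  finally have m: "card B < 2 ^ m" .
  have "1 \<le> real (N * 2 ^ N)"
  proof -
    have "0 < N * 2 ^ N" using N1 by simp
    then show ?thesis by linarith
  qed
  moreover have "\<exists>y\<in>Q. sum w B \<le> real (N * 2 ^ N) * sum w {b\<in>B. below_on K y (v b)}"
    if "\<And>b. w b > 0" for w :: "'b \<Rightarrow> real"
  proof (rule fractional_helly[OF assms(1,3,4) False that N1])
    fix s assume "s \<in> {..<N} \<rightarrow> B"
    then show "\<exists>I\<subseteq>{..<N}. card I = card K + 1 \<and> coord_min (\<lambda>i. v (s i)) I \<in> Q"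
      unfolding N assms(2) using pq_for_sequences[OF assms(4,3,5,6) p pq] by blast
  qed
  ultimately obtain x where x: "\<forall>i<r * m. x i \<in> Q"
    "\<forall>b\<in>B. m \<le> card {i\<in>{..<r * m}. below_on K (x i) (v b)}"
    using often_hitting_sequence[OF assms(4) _ _ r m, where R = "\<lambda>y b. below_on K y (v b)" and X = Q]
    by blast
  have "card {..<r * m} \<le> r * (k + 1) * M" "M \<ge> 1"
    by (simp_all only: card_lessThan m_def M_def mult.assoc order_refl le_add2)
  from weak_net[OF assms(1) finite_lessThan this, of x]
  obtain F where F: "finite F" "card F \<le> (r * (k + 1)) ^ k"
    "\<forall>y\<in>F. \<exists>i\<in>{..<r * m}. below_on K (x i) y"
    "\<forall>b. m \<le> card {i\<in>{..<r * m}. below_on K (x i) b} \<longrightarrow> (\<exists>y\<in>F. below_on K y b)"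
    unfolding assms(2) m_def by blast
  have "F \<subseteq> Q" using F(3) x(1) assms(3) unfolding upset_on_def by blast
  then show ?thesis using F(1,2,4) x(2) by blast
qed

section \<open>Offset vectors of \<open>H\<close>-convex sets\<close>

definition region :: "nat \<Rightarrow> 'h set \<Rightarrow> ('h \<Rightarrow> real vec) \<Rightarrow> ('h \<Rightarrow> real) \<Rightarrow> real vec set" where
  "region d H a f = {x \<in> carrier_vec d. \<forall>h\<in>H. a h \<bullet> x \<le> f h}"

lemma region_mono: "below_on H f g \<Longrightarrow> region d H a f \<subseteq> region d H a g"
  unfolding region_def below_on_def by fastforce

lemma region_coord_min:
  assumes "finite L" "L \<noteq> {}"
  shows "region d H a (coord_min f L) = (\<Inter>B\<in>L. region d H a (f B))"
proof -
  have "c \<le> coord_min f L h \<longleftrightarrow> (\<forall>B\<in>L. c \<le> f B h)" for c h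
    unfolding coord_min_def using assms by simp
  then show ?thesis using assms(2) unfolding region_def by auto
qed

lemma translate_image:
  assumes "a \<in> carrier_vec d" "v \<in> carrier_vec d"
  shows "(\<lambda>x. x + v) ` {x \<in> carrier_vec d. a \<bullet> x \<le> b} = {x \<in> carrier_vec d. a \<bullet> x \<le> b + a \<bullet> (v :: real vec)}"
    (is "?L = ?R")
proof
  show "?L \<subseteq> ?R" using assms by (auto simp: scalar_prod_add_distrib[of _ d])
  show "?R \<subseteq> ?L"
  proof
    fix x assume "x \<in> ?R"
    then have x: "x \<in> carrier_vec d" "a \<bullet> x \<le> b + a \<bullet> v" by auto
    have "x = (x - v) + v" using x(1) assms(2) by auto
    moreover have "a \<bullet> (x - v) \<le> b"
      using x assms by (simp add: scalar_prod_minus_distrib[of _ d])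
    ultimately show "x \<in> ?L"
      using x(1) assms(2) by (intro image_eqI[of _ _ "x - v"]) auto
  qed
qed

text \<open>
  A translation by \<open>v\<close> shifts the offset by \<open>a \<bullet> v\<close>, and since \<open>a\<close> is nonzero, multiples of \<open>a\<close> itself
  realise every shift. Hence the offset of a translate is an unrestricted real number.
\<close>

lemma translate_of_halfspace_iff:
  assumes a: "a \<in> carrier_vec d" "a \<noteq> 0\<^sub>v d"
  shows "translate_of d h' {x \<in> carrier_vec d. a \<bullet> x \<le> b} \<longleftrightarrow> (\<exists>b'. h' = {x \<in> carrier_vec d. a \<bullet> x \<le> b'})"
proof
  assume "translate_of d h' {x \<in> carrier_vec d. a \<bullet> x \<le> b}"
  then show "\<exists>b'. h' = {x \<in> carrier_vec d. a \<bullet> x \<le> b'}"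
    unfolding translate_of_def using translate_image[OF a(1)] by auto
next
  assume "\<exists>b'. h' = {x \<in> carrier_vec d. a \<bullet> x \<le> b'}"
  then obtain b' where b': "h' = {x \<in> carrier_vec d. a \<bullet> x \<le> b'}" by blast
  have "a \<bullet> a \<noteq> 0"
    using conjugate_square_eq_0_vec[OF a(1)] a(2) by (simp add: conjugate_vec_def vec_eq_iff)
  define v where "v = ((b' - b) / (a \<bullet> a)) \<cdot>\<^sub>v a"
  have v: "v \<in> carrier_vec d" unfolding v_def using a(1) by simp
  have "a \<bullet> v = b' - b" unfolding v_def using a(1) \<open>a \<bullet> a \<noteq> 0\<close> by simp
  then have "h' = (\<lambda>x. x + v) ` {x \<in> carrier_vec d. a \<bullet> x \<le> b}"
    using translate_image[OF a(1) v, of b] b' by simp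
  then show "translate_of d h' {x \<in> carrier_vec d. a \<bullet> x \<le> b}"
    unfolding translate_of_def using v by blast
qed

lemma H_convex_iff_region:
  assumes "\<forall>h\<in>H. closed_halfspace d h"
  obtains a where "\<And>B. H_convex d H B \<longleftrightarrow> (\<exists>f. B = region d H a f)"
proof -
  have "\<forall>h\<in>H. \<exists>a. \<forall>h'. translate_of d h' h \<longleftrightarrow> (\<exists>b'. h' = {x \<in> carrier_vec d. a \<bullet> x \<le> b'})"
  proof
    fix h assume "h \<in> H"
    then obtain a b where "a \<in> carrier_vec d" "a \<noteq> 0\<^sub>v d" "h = {x \<in> carrier_vec d. a \<bullet> x \<le> b}"
      using assms unfolding closed_halfspace_def by blast
    then show "\<exists>a. \<forall>h'. translate_of d h' h \<longleftrightarrow> (\<exists>b'. h' = {x \<in> carrier_vec d. a \<bullet> x \<le> b'})"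
      using translate_of_halfspace_iff by blast
  qed
  then obtain a where a: "\<And>h h'. h \<in> H \<Longrightarrow>
      translate_of d h' h \<longleftrightarrow> (\<exists>b'. h' = {x \<in> carrier_vec d. a h \<bullet> x \<le> b'})"
    by metis
  have "H_convex d H B \<longleftrightarrow> (\<exists>f. B = region d H a f)" for B
  proof
    assume "H_convex d H B"
    then obtain T where T: "\<forall>h\<in>H. translate_of d (T h) h" "B = carrier_vec d \<inter> (\<Inter>h\<in>H. T h)"
      unfolding H_convex_def by blast
    have "\<forall>h\<in>H. \<exists>b'. T h = {x \<in> carrier_vec d. a h \<bullet> x \<le> b'}"
      using T(1) a by blast
    then obtain f where "\<forall>h\<in>H. T h = {x \<in> carrier_vec d. a h \<bullet> x \<le> f h}"
      by metis
    then have "B = region d H a f"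
      unfolding T(2) region_def by auto
    then show "\<exists>f. B = region d H a f" by blast
  next
    assume "\<exists>f. B = region d H a f"
    then obtain f where f: "B = region d H a f" by blast
    define T where "T h = {x \<in> carrier_vec d. a h \<bullet> x \<le> f h}" for h
    have "\<forall>h\<in>H. translate_of d (T h) h"
      using a unfolding T_def by blast
    moreover have "B = carrier_vec d \<inter> (\<Inter>h\<in>H. T h)"
      unfolding f region_def T_def by auto
    ultimately show "H_convex d H B" unfolding H_convex_def by blast
  qed
  then show thesis using that by blast
qed

section \<open>The theorem for \<open>H\<close>-convex sets\<close>

theorem theorem2p9:
  fixes p q k :: nat
  assumes "p \<ge> q" and "q \<ge> k + 1"
  shows "\<exists>c::nat. \<forall>(d::nat) (H :: real vec set set) (P :: real vec set set) (\<B> :: real vec set set).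
    finite H \<and> card H = k \<and> (\<forall>h\<in>H. closed_halfspace d h) \<and>
    monotone_property d H P \<and>
    finite \<B> \<and> (\<forall>B\<in>\<B>. H_convex d H B) \<and> (\<forall>B\<in>\<B>. B \<in> P) \<and>
    (\<forall>\<G>\<subseteq>\<B>. card \<G> = p \<longrightarrow> (\<exists>\<K>\<subseteq>\<G>. card \<K> = q \<and> P_intersecting P \<K>))
    \<longrightarrow>
    (\<exists>\<F>. finite \<F> \<and> card \<F> \<le> c \<and> (\<forall>D\<in>\<F>. H_convex d H D \<and> D \<in> P) \<and>
         (\<forall>B\<in>\<B>. \<exists>D\<in>\<F>. D \<subseteq> B))"
proof -
  define N where "N = (k + 1) * p"
  have "N \<ge> 1" unfolding N_def using assms by simp
  then have "1 - 1 / (2 * real (N * 2 ^ N)) < 1" by simp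
  from real_arch_pow_inv[OF _ this, of "1 / 4"]
  obtain r where r: "(1 - 1 / (2 * real (N * 2 ^ N))) ^ r \<le> 1 / 4"
    by (auto intro: less_imp_le)
  show ?thesis
  proof (intro exI[of _ "(r * (k + 1)) ^ k"] allI impI, elim conjE)
    fix d :: nat and H P \<B> :: "real vec set set"
    assume H: "finite H" "card H = k" "\<forall>h\<in>H. closed_halfspace d h"
      and P: "monotone_property d H P"
      and \<B>: "finite \<B>" "\<forall>B\<in>\<B>. H_convex d H B" "\<forall>B\<in>\<B>. B \<in> P"
      and pq: "\<forall>\<G>\<subseteq>\<B>. card \<G> = p \<longrightarrow> (\<exists>\<K>\<subseteq>\<G>. card \<K> = q \<and> P_intersecting P \<K>)"
    obtain a where a: "\<And>B. H_convex d H B \<longleftrightarrow> (\<exists>f. B = region d H a f)"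
      using H_convex_iff_region[OF H(3)] by blast
    let ?D = "region d H a"
    \<comment> \<open>offset vectors are not unique; any choice will do, since \<open>?D\<close> turns minima into intersections\<close>
    obtain f where f: "\<And>B. B \<in> \<B> \<Longrightarrow> ?D (f B) = B"
      using \<B>(2) a by metis
    define Q where "Q = {y. ?D y \<in> P}"
    have up: "upset_on H Q"
      unfolding upset_on_def Q_def
      using P region_mono[of H] a unfolding monotone_property_def by blast
    have fQ: "f B \<in> Q" if "B \<in> \<B>" for B
      using that f \<B>(3) unfolding Q_def by simp
    have "\<exists>L\<subseteq>G. card L = q \<and> coord_min f L \<in> Q" if G: "G \<subseteq> \<B>" "card G = p" for G
    proof -
      obtain L where L: "L \<subseteq> G" "card L = q" "\<Inter>L \<in> P"
        using pq G unfolding P_intersecting_def by blast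
      have "card L > 0" using L(2) assms(2) by simp
      then have "finite L" "L \<noteq> {}" by (simp_all add: card_gt_0_iff)
      then have "?D (coord_min f L) = (\<Inter>B\<in>L. ?D (f B))" by (rule region_coord_min)
      also have "(\<lambda>B. ?D (f B)) ` L = (\<lambda>B. B) ` L"
        using L(1) G(1) f by (intro image_cong) auto
      then have "(\<Inter>B\<in>L. ?D (f B)) = \<Inter>L" by simp
      finally show ?thesis using L unfolding Q_def by auto
    qed
    from upset_pq[OF H(1,2) up \<B>(1) fQ assms(2,1) this N_def r]
    obtain F where F: "F \<subseteq> Q" "finite F" "card F \<le> (r * (k + 1)) ^ k"
      "\<forall>B\<in>\<B>. \<exists>y\<in>F. below_on H y (f B)" by blast
    show "\<exists>\<F>. finite \<F> \<and> card \<F> \<le> (r * (k + 1)) ^ k \<and> (\<forall>D\<in>\<F>. H_convex d H D \<and> D \<in> P) \<and>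
         (\<forall>B\<in>\<B>. \<exists>D\<in>\<F>. D \<subseteq> B)"
    proof (intro exI[of _ "?D ` F"] conjI ballI)
      show "finite (?D ` F)" using F(2) by simp
      show "card (?D ` F) \<le> (r * (k + 1)) ^ k"
        using card_image_le[OF F(2)] F(3) by (rule order_trans)
    next
      fix D assume "D \<in> ?D ` F"
      then show "H_convex d H D" "D \<in> P" using F(1) a unfolding Q_def by auto
    next
      fix B assume B: "B \<in> \<B>"
      then obtain y where y: "y \<in> F" "below_on H y (f B)" using F(4) by blast
      have "?D y \<subseteq> B" using region_mono[OF y(2), of d a] f[OF B] by simp
      then show "\<exists>D\<in>?D ` F. D \<subseteq> B" using y(1) by blast
    qed
  qed
qed

end
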